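(* Let $p\geq q\geq 2$ be integers such that $p\leq q^2-q$ and $\gcd(p,q)=q$, and let $\mathcal{L}$ denote the equation $px+qy=z$. Then $$f_{\max}(n,\mathcal{L})\leq 2^{(\mu_{\mathcal{L}}(n)-\mu^*_{\mathcal{L}}(n))/2+o(n)}.$$
   Context: $[n]=\{1,\dots,n\}$. A set $A\subseteq[n]$ is $\mathcal{L}$-free, for $\mathcal{L}$ the equation $px+qy=z$ with $p,q$ as in the statement, if there are no $x,y,z\in A$ (not necessarily distinct) with $px+qy=z$ (such an equation has no trivial solutions). A set $S\subseteq[n]$ is a maximal $\mathcal{L}$-free subset of $[n]$ if it is $\mathcal{L}$-free and not properly contained in another $\mathcal{L}$-free subset of $[n]$; $f_{\max}(n,\mathcal{L})$ is the number of these. $\mu_{\mathcal{L}}(n)$ is the size of the largest $\mathcal{L}$-free subset of $[n]$. An $\mathcal{L}$-triple is a multiset $\{x,y,z\}$ which (in some order) forms a solution to $\mathcal{L}$. $\mu^*_{\mathcal{L}}(n)$ is the number of elements of $[n]$ that do not lie in any $\mathcal{L}$-triple contained in $[n]$. The $o(n)$ term is as $n\to\infty$ with $p,q$ fixed. *)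

theory Defs
  imports Complex_Main "HOL-Library.Multiset" "HOL-Library.Landau_Symbols"
begin

(* Throughout, the equation L : p x + q y = z is represented by its coefficients p, q,
   and [n] is the set {1..n} of natural numbers. *)

definition solution :: "nat \<Rightarrow> nat \<Rightarrow> nat \<Rightarrow> nat \<Rightarrow> nat \<Rightarrow> bool" where
  "solution p q x y z \<longleftrightarrow> p * x + q * y = z"

(* x, y, z need not be distinct. *)
definition L_free :: "nat \<Rightarrow> nat \<Rightarrow> nat set \<Rightarrow> bool" where
  "L_free p q A \<longleftrightarrow> \<not> (\<exists>x\<in>A. \<exists>y\<in>A. \<exists>z\<in>A. solution p q x y z)"

definition maximal_L_free :: "nat \<Rightarrow> nat \<Rightarrow> nat \<Rightarrow> nat set \<Rightarrow> bool" where
  "maximal_L_free p q n S \<longleftrightarrow>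
     S \<subseteq> {1..n} \<and> L_free p q S \<and> \<not> (\<exists>T. T \<subseteq> {1..n} \<and> L_free p q T \<and> S \<subset> T)"

definition f_max :: "nat \<Rightarrow> nat \<Rightarrow> nat \<Rightarrow> nat" where
  "f_max p q n = card {S. maximal_L_free p q n S}"

definition mu :: "nat \<Rightarrow> nat \<Rightarrow> nat \<Rightarrow> nat" where
  "mu p q n = Max (card ` {A. A \<subseteq> {1..n} \<and> L_free p q A})"

(* Equality of multisets accounts for the solution being formed "in some order". *)
definition L_triple :: "nat \<Rightarrow> nat \<Rightarrow> nat multiset \<Rightarrow> bool" where
  "L_triple p q M \<longleftrightarrow> (\<exists>x y z. M = {#x, y, z#} \<and> solution p q x y z)"

definition mu_star :: "nat \<Rightarrow> nat \<Rightarrow> nat \<Rightarrow> nat" where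
  "mu_star p q n =
     card {a \<in> {1..n}. \<not> (\<exists>M. L_triple p q M \<and> set_mset M \<subseteq> {1..n} \<and> a \<in># M)}"

end

theory Submission
  imports Defs "HOL-Real_Asymp.Real_Asymp"
begin

text \<open>
  Write \<open>p = r q\<close> with \<open>r + 1 \<le> q\<close>, so that the equation reads \<open>z = q (r x + y)\<close>, and let
  \<open>M = n div q\<close>. If \<open>(r + 1) (b + 1) > M\<close>, no solution uses two elements of \<open>]b, n]\<close>
  that are not of the form \<open>q w\<close> with \<open>w > b\<close>, so a maximal solution-free set \<open>S\<close> is determined by
  \<open>S \<inter> [1, b]\<close> and by the multiples \<open>q w \<in> S\<close> with \<open>w > b\<close>. Such a \<open>w\<close> is a gap, that is,
  \<open>w \<notin> r S + S\<close>. Choose \<open>b \<ge> M / (r + 1)\<close> as the end of the topmost short interval containing many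
  gaps (or as \<open>M div (r + 1)\<close>). Then few gaps lie above \<open>b\<close>, and \<open>S \<inter> [1, b]\<close> is an independent set
  of the nearly regular bipartite graph joining \<open>x \<le> b / (r + 1)\<close> to \<open>g - r x\<close> for many gaps \<open>g \<approx> b\<close>.
  A greedy fingerprint argument bounds the number of such sets by \<open>2 ^ (r M / (r + 1) + o(n))\<close>, and
  \<open>r M / (r + 1)\<close> is at most \<open>(\<mu> - \<mu>\<^sup>*) / 2 + O(1)\<close> because \<open>r + 1 \<le> q\<close>.
\<close>

section \<open>Fingerprints and the count of independent sets in bipartite graphs\<close>

lemma card_subsets_card_le:
  assumes "finite X"
  shows "card {A. A \<subseteq> X \<and> card A \<le> k} \<le> (card X + 1) ^ k"
proof (induction k)
  case 0
  have "{A. A \<subseteq> X \<and> card A \<le> 0} = {{}}"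
    using assms by (auto dest: finite_subset)
  then show ?case by simp
next
  case (Suc k)
  let ?F = "\<lambda>k. {A. A \<subseteq> X \<and> card A \<le> k}"
  have fin: "finite (?F k)" for k
    using assms by simp
  have "?F (Suc k) \<subseteq> ?F k \<union> (\<lambda>(x, A). insert x A) ` (X \<times> ?F k)"
  proof
    fix A assume A: "A \<in> ?F (Suc k)"
    show "A \<in> ?F k \<union> (\<lambda>(x, A). insert x A) ` (X \<times> ?F k)"
    proof (cases "card A \<le> k")
      case True
      then show ?thesis using A by auto
    next
      case False
      then have "A \<noteq> {}" by auto
      then obtain x where x: "x \<in> A" by blast
      have "finite A" using A assms by (auto dest: finite_subset)
      then have "card (A - {x}) \<le> k" using A x by auto
      then have "(x, A - {x}) \<in> X \<times> ?F k" using A x by auto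
      moreover have "A = (\<lambda>(x, A). insert x A) (x, A - {x})" using x by auto
      ultimately show ?thesis by blast
    qed
  qed
  then have "card (?F (Suc k)) \<le> card (?F k \<union> (\<lambda>(x, A). insert x A) ` (X \<times> ?F k))"
    using fin assms by (intro card_mono) auto
  also have "\<dots> \<le> card (?F k) + card (X \<times> ?F k)"
    using fin assms
    by (intro order_trans[OF card_Un_le] add_left_mono card_image_le finite_cartesian_product)
  also have "\<dots> = (card X + 1) * card (?F k)"
    by (simp add: card_cartesian_product)
  also have "\<dots> \<le> (card X + 1) ^ Suc k"
    using mult_le_mono2[OF Suc, of "card X + 1"] by (simp only: power_Suc)
  finally show ?case .
qed

text \<open>Take \<open>A\<close> of maximum size among the subsets of \<open>I\<close> whose union
  has at least \<open>d\<close> elements per member of \<open>A\<close>. An \<open>x\<close> with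
  \<open>d\<close> elements outside this union could be inserted into \<open>A\<close>, against
  maximality.\<close>

lemma exists_fingerprint:
  fixes N :: "'a \<Rightarrow> 'b set"
  assumes "finite I" "\<And>x. x \<in> I \<Longrightarrow> finite (N x)" "d > 0"
  obtains A where "A \<subseteq> I" "d * card A \<le> card (\<Union>(N ` A))"
    "\<And>x. x \<in> I \<Longrightarrow> card (N x - \<Union>(N ` A)) < d"
proof -
  let ?F = "{A. A \<subseteq> I \<and> d * card A \<le> card (\<Union>(N ` A))}"
  have fin: "finite ?F" using assms by simp
  have "{} \<in> ?F" by simp
  then have "Max (card ` ?F) \<in> card ` ?F" using fin by (intro Max_in) auto
  then obtain A where A: "A \<in> ?F" and "Max (card ` ?F) = card A" by (rule imageE)
  then have max: "card B \<le> card A" if "B \<in> ?F" for B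
    using Max_ge[OF finite_imageI[OF fin] imageI[OF that], of card] by simp
  have "card (N x - \<Union>(N ` A)) < d" if x: "x \<in> I" for x
  proof (rule ccontr)
    assume less: "\<not> ?thesis"
    have finA: "finite A" using A assms by (auto dest: finite_subset)
    have "x \<notin> A"
    proof
      assume "x \<in> A"
      then have "N x - \<Union>(N ` A) = {}" by blast
      then show False using less assms(3) by (metis card.empty)
    qed
    have "\<Union>(N ` insert x A) = (N x - \<Union>(N ` A)) \<union> \<Union>(N ` A)" by auto
    moreover have "card \<dots> = card (N x - \<Union>(N ` A)) + card (\<Union>(N ` A))"
      using A assms x finA by (intro card_Un_disjoint) auto
    ultimately have "d * card (insert x A) \<le> card (\<Union>(N ` insert x A))"
      using A less \<open>x \<notin> A\<close> finA by simp
    then have "insert x A \<in> ?F" using A x by simp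
    from max[OF this] show False using \<open>x \<notin> A\<close> finA by simp
  qed
  then show ?thesis using that A by blast
qed

text \<open>A container argument for the graph joining \<open>x\<close> to the elements of
  \<open>N x\<close>. A fingerprint \<open>A\<close> of the part of \<open>V\<close> in
  \<open>X\<close>, taken with \<open>d = t\<close>, has at most \<open>card Y div t\<close>
  elements and confines \<open>V\<close> to a container \<open>C A\<close>. The degree conditions
  keep every container almost as small as \<open>Y\<close>, so fingerprints times subsets of a
  container bounds the count.\<close>

lemma card_independent_sets_le:
  fixes X Y :: "'a set"
  assumes fin: "finite X" "finite Y" and t: "t > 0"
    and N: "\<And>x. x \<in> X \<Longrightarrow> N x \<subseteq> Y" "\<And>x. x \<in> X \<Longrightarrow> t * t \<le> card (N x)"
    and deg: "\<And>y. y \<in> Y \<Longrightarrow> card {x \<in> X. y \<in> N x} \<le> t * t"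
  shows "card {V. V \<subseteq> X \<union> Y \<and> (\<forall>x \<in> V \<inter> X. N x \<inter> V = {})}
    \<le> (card X + 1) ^ (card Y div t) * 2 ^ (card Y + card X div t)"
proof -
  let ?F = "{V. V \<subseteq> X \<union> Y \<and> (\<forall>x \<in> V \<inter> X. N x \<inter> V = {})}"
  let ?A = "{A. A \<subseteq> X \<and> card A \<le> card Y div t}"
  \<comment> \<open>An independent \<open>V\<close> with fingerprint \<open>A\<close> misses
    \<open>W A\<close>, and its vertices in \<open>X\<close> have almost all their neighbours in
    \<open>W A\<close>, so they lie in \<open>Q A\<close>.\<close>
  define W where "W A = \<Union>(N ` A)" for A
  define Q where "Q A = {x \<in> X. card (N x - W A) < t}" for A
  define C where "C A = Q A \<union> (Y - W A)" for A
  have finN: "finite (N x)" if "x \<in> X" for x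
    using N(1)[OF that] fin(2) by (rule finite_subset)
  have cov: "?F \<subseteq> (\<Union>A\<in>?A. Pow (C A))"
  proof
    fix V assume V: "V \<in> ?F"
    have "finite (V \<inter> X)" using fin by simp
    then obtain A where A: "A \<subseteq> V \<inter> X" "t * card A \<le> card (W A)"
      "\<And>x. x \<in> V \<inter> X \<Longrightarrow> card (N x - W A) < t"
      using exists_fingerprint[of "V \<inter> X" N t] finN t unfolding W_def by blast
    have "W A \<subseteq> Y" using A(1) N(1) unfolding W_def by blast
    then have "t * card A \<le> card Y" using A(2) card_mono[OF fin(2)] order_trans by blast
    then have "card A \<le> card Y div t"
      by (simp add: less_eq_div_iff_mult_less_eq[OF t] mult.commute)
    moreover have "V \<inter> W A = {}" using V A(1) unfolding W_def by auto
    ultimately show "V \<in> (\<Union>A\<in>?A. Pow (C A))"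
      using V A unfolding C_def Q_def by auto
  qed
  have cC: "card (C A) \<le> card Y + card X div t" if "A \<subseteq> X" for A
  proof -
    have WY: "W A \<subseteq> Y" using N(1) that unfolding W_def by blast
    have finW: "finite (W A)" using WY fin(2) finite_subset by blast
    have QX: "Q A \<subseteq> X" unfolding Q_def by auto
    have finQ: "finite (Q A)" using QX fin(1) finite_subset by blast
    \<comment> \<open>Double counting of the edges between \<open>Q A\<close> and
      \<open>W A\<close>: each vertex of \<open>Q A\<close> sends more than \<open>t * t - t\<close>
      of them, and each vertex of \<open>W A\<close> receives at most \<open>t * t\<close>. Hence
      what \<open>Q A\<close> adds to the container exceeds what \<open>W A\<close> removes by at
      most \<open>card X div t\<close>.\<close>
    have "t * t * card (Q A) = (\<Sum>x\<in>Q A. t * t)" by simp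
    also have "\<dots> \<le> (\<Sum>x\<in>Q A. card (N x \<inter> W A) + t)"
    proof (rule sum_mono)
      fix x assume x: "x \<in> Q A"
      then have "t * t \<le> card (N x)" using N(2) QX by blast
      also have "\<dots> = card (N x \<inter> W A) + card (N x - W A)"
        using finN x QX card_Int_Diff by blast
      finally show "t * t \<le> card (N x \<inter> W A) + t" using x unfolding Q_def by simp
    qed
    also have "\<dots> = (\<Sum>x\<in>Q A. card (N x \<inter> W A)) + t * card (Q A)"
      by (simp add: sum.distrib)
    also have "(\<Sum>x\<in>Q A. card (N x \<inter> W A)) = (\<Sum>x\<in>Q A. card {y \<in> W A. y \<in> N x})"
      by (intro sum.cong) (auto intro: arg_cong[of _ _ card])
    also have "\<dots> = (\<Sum>y\<in>W A. card {x \<in> Q A. y \<in> N x})"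
      using sum.swap_restrict[of "Q A" "W A" "\<lambda>_ _. 1::nat" "\<lambda>x y. y \<in> N x"] finQ finW by simp
    also have "\<dots> \<le> (\<Sum>y\<in>W A. t * t)"
    proof (rule sum_mono)
      fix y assume y: "y \<in> W A"
      have "card {x \<in> Q A. y \<in> N x} \<le> card {x \<in> X. y \<in> N x}"
        using QX fin by (intro card_mono) auto
      also have "\<dots> \<le> t * t" using deg y WY by blast
      finally show "card {x \<in> Q A. y \<in> N x} \<le> t * t" .
    qed
    finally have "t * (t * card (Q A)) \<le> t * (t * card (W A) + card (Q A))"
      by (simp add: algebra_simps)
    then have "t * card (Q A) \<le> t * card (W A) + card (Q A)" using t by simp
    then have "t * (card (Q A) - card (W A)) \<le> card (Q A)" by (simp add: diff_mult_distrib2)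
    also have "\<dots> \<le> card X" by (rule card_mono[OF fin(1) QX])
    finally have "card (Q A) - card (W A) \<le> card X div t"
      by (simp add: less_eq_div_iff_mult_less_eq[OF t] mult.commute)
    moreover have "card (C A) \<le> card (Q A) + (card Y - card (W A))"
      unfolding C_def using card_Un_le[of "Q A" "Y - W A"] card_Diff_subset[OF finW WY] by simp
    moreover have "card (W A) \<le> card Y" by (rule card_mono[OF fin(2) WY])
    ultimately show ?thesis by linarith
  qed
  have finA: "finite ?A" using fin by simp
  have finC: "finite (C A)" for A unfolding C_def Q_def using fin by simp
  have "card ?F \<le> card (\<Union>A\<in>?A. Pow (C A))"
    using cov finA finC by (intro card_mono) auto
  also have "\<dots> \<le> (\<Sum>A\<in>?A. card (Pow (C A)))" by (rule card_UN_le[OF finA])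
  also have "\<dots> \<le> (\<Sum>A\<in>?A. 2 ^ (card Y + card X div t))"
    using cC finC by (intro sum_mono) (auto simp: card_Pow intro!: power_increasing)
  also have "\<dots> \<le> (card X + 1) ^ (card Y div t) * 2 ^ (card Y + card X div t)"
    using card_subsets_card_le[OF fin(1)] by simp
  finally show ?thesis .
qed

text \<open>Join \<open>x\<close> in \<open>{1..c}\<close> to \<open>g - r * x\<close> for
  \<open>g\<close> in \<open>G\<close>. As \<open>g\<close> exceeds \<open>(r + 1) * c\<close>, all
  these neighbours lie in \<open>{c+1..b}\<close>, and there are exactly \<open>t * t\<close> of
  them. Conversely \<open>y\<close> is adjacent to at most \<open>t * t\<close> vertices, since
  \<open>r * x + y\<close> lies in \<open>G\<close> and determines \<open>x\<close>. A set avoiding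
  sums in \<open>G\<close> is independent in this graph.\<close>

lemma card_sum_avoiding_le:
  fixes r t b c :: nat
  assumes r: "r \<ge> 1" and t: "t > 0" and cb: "c \<le> b"
    and G: "G \<subseteq> {..b}" "card G = t * t" "\<And>g. g \<in> G \<Longrightarrow> (r + 1) * c < g"
  shows "card {V. V \<subseteq> {1..b} \<and> (\<forall>x\<in>V. \<forall>y\<in>V. r * x + y \<notin> G)}
    \<le> (b + 1) ^ (b div t) * 2 ^ (b - c + b div t)"
proof -
  let ?N = "\<lambda>x. (\<lambda>g. g - r * x) ` G"
  let ?X = "{1..c}" and ?Y = "{c+1..b}"
  have finG: "finite G" using G(1) finite_subset by blast
  have large: "r * x + c < g" if "x \<in> ?X" "g \<in> G" for x g
  proof -
    have "r * x + c \<le> (r + 1) * c" using that by simp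
    then show ?thesis using G(3)[OF that(2)] by linarith
  qed
  have "card {V. V \<subseteq> {1..b} \<and> (\<forall>x\<in>V. \<forall>y\<in>V. r * x + y \<notin> G)}
      \<le> card {V. V \<subseteq> ?X \<union> ?Y \<and> (\<forall>x \<in> V \<inter> ?X. ?N x \<inter> V = {})}"
  proof (rule card_mono)
    show "finite {V. V \<subseteq> ?X \<union> ?Y \<and> (\<forall>x \<in> V \<inter> ?X. ?N x \<inter> V = {})}" by simp
    show "{V. V \<subseteq> {1..b} \<and> (\<forall>x\<in>V. \<forall>y\<in>V. r * x + y \<notin> G)}
      \<subseteq> {V. V \<subseteq> ?X \<union> ?Y \<and> (\<forall>x \<in> V \<inter> ?X. ?N x \<inter> V = {})}"
    proof clarify
      fix V assume V: "V \<subseteq> {1..b}" "\<forall>x\<in>V. \<forall>y\<in>V. r * x + y \<notin> G"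
      have "V \<subseteq> ?X \<union> ?Y" using V(1) by force
      moreover have "?N x \<inter> V = {}" if "x \<in> V \<inter> ?X" for x
      proof -
        have "g - r * x \<notin> V" if "g \<in> G" for g
        proof
          assume "g - r * x \<in> V"
          then have "r * x + (g - r * x) \<notin> G" using V(2) \<open>x \<in> V \<inter> ?X\<close> by blast
          then show False using large[of x g] \<open>x \<in> V \<inter> ?X\<close> \<open>g \<in> G\<close> by simp
        qed
        then show ?thesis by auto
      qed
      ultimately show "V \<subseteq> ?X \<union> ?Y \<and> (\<forall>x \<in> V \<inter> ?X. ?N x \<inter> V = {})" by blast
    qed
  qed
  also have "\<dots> \<le> (card ?X + 1) ^ (card ?Y div t) * 2 ^ (card ?Y + card ?X div t)"
  proof (rule card_independent_sets_le)
    show "finite ?X" "finite ?Y" by simp_all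
    show "t > 0" by (rule t)
  next
    fix x assume x: "x \<in> ?X"
    show "?N x \<subseteq> ?Y"
    proof clarify
      fix g assume "g \<in> G"
      then show "g - r * x \<in> ?Y" using large[OF x] G(1) by fastforce
    qed
    have "inj_on (\<lambda>g. g - r * x) G"
      using large[OF x] by (intro inj_onI) (metis add_leD1 eq_diff_iff less_or_eq_imp_le)
    then show "t * t \<le> card (?N x)" by (simp add: card_image G(2))
  next
    fix y assume "y \<in> ?Y"
    have "card {x \<in> ?X. y \<in> ?N x} \<le> card G"
    proof (rule card_inj_on_le[of "\<lambda>x. r * x + y"])
      show "inj_on (\<lambda>x. r * x + y) {x \<in> ?X. y \<in> ?N x}"
        using r by (intro inj_onI) simp
      show "(\<lambda>x. r * x + y) ` {x \<in> ?X. y \<in> ?N x} \<subseteq> G"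
      proof clarify
        fix x g assume "x \<in> ?X" "g \<in> G"
        then show "r * x + (g - r * x) \<in> G" using large[of x g] by simp
      qed
    qed (rule finG)
    then show "card {x \<in> ?X. y \<in> ?N x} \<le> t * t" by (simp add: G(2))
  qed
  also have "\<dots> \<le> (b + 1) ^ (b div t) * 2 ^ (b - c + b div t)"
  proof (rule mult_mono)
    have "(c + 1) ^ ((b - c) div t) \<le> (b + 1) ^ ((b - c) div t)"
      using cb by (intro power_mono) auto
    also have "\<dots> \<le> (b + 1) ^ (b div t)"
      by (intro power_increasing div_le_mono) auto
    finally show "(card ?X + 1) ^ (card ?Y div t) \<le> (b + 1) ^ (b div t)" by simp
    show "(2::nat) ^ (card ?Y + card ?X div t) \<le> 2 ^ (b - c + b div t)"
      using cb div_le_mono[OF cb, of t] by (intro power_increasing) auto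
  qed auto
  finally show ?thesis .
qed

section \<open>Reconstruction of a maximal solution-free set from its data at a cut\<close>

lemma L_free_mult_iff:
  "L_free (r * q) q A \<longleftrightarrow> (\<forall>x\<in>A. \<forall>y\<in>A. q * (r * x + y) \<notin> A)"
proof -
  have "r * q * x + q * y = q * (r * x + y)" for x y by (simp add: algebra_simps)
  then show ?thesis unfolding L_free_def solution_def by metis
qed

text \<open>If \<open>u\<close> were in \<open>S\<close> but not in \<open>T\<close>, maximality of
  \<open>T\<close> would give a solution in \<open>insert u T\<close>. The agreement of
  \<open>S\<close> and \<open>T\<close> moves this whole solution into \<open>S\<close>, which is
  solution-free.\<close>

lemma maximal_L_free_subset_eq:
  assumes q: "q \<ge> 1" and r: "r \<ge> 1" and b: "n div q < (r + 1) * (b + 1)"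
    and S: "maximal_L_free (r * q) q n S" and T: "maximal_L_free (r * q) q n T"
    and low: "\<And>v. v \<le> b \<Longrightarrow> v \<in> S \<longleftrightarrow> v \<in> T"
    and high: "\<And>w. b < w \<Longrightarrow> q * w \<in> S \<longleftrightarrow> q * w \<in> T"
  shows "S \<subseteq> T"
proof
  fix u assume uS: "u \<in> S"
  show "u \<in> T"
  proof (rule ccontr)
    assume uT: "u \<notin> T"
    have Sn: "S \<subseteq> {1..n}" and Tn: "T \<subseteq> {1..n}"
      and Sfree: "L_free (r * q) q S"
      using S T unfolding maximal_L_free_def by auto
    have "insert u T \<subseteq> {1..n}" "T \<subset> insert u T" using uS uT Sn Tn by auto
    then have "\<not> L_free (r * q) q (insert u T)"
      using T unfolding maximal_L_free_def by blast
    then obtain x y z where xyz: "x \<in> insert u T" "y \<in> insert u T" "z \<in> insert u T"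
      and z: "z = q * (r * x + y)"
      unfolding L_free_mult_iff by blast
    have nosol: "\<not> (x \<in> S \<and> y \<in> S \<and> z \<in> S)"
      using Sfree z unfolding L_free_mult_iff by blast
    have pos: "x \<ge> 1" "y \<ge> 1" "z \<le> n" "z \<ge> 1" using xyz uS Sn Tn by auto
    have ub: "u > b"
      using low[of u] uS uT by force
    have lowS: "v \<in> S" if "v \<in> insert u T" "v \<le> b \<or> v = u" for v
      using that low[of v] uS by blast
    have wn: "r * x + y \<le> n div q"
      using pos(3) q z by (simp add: less_eq_div_iff_mult_less_eq mult.commute)
    have xw: "x \<le> r * x + y" and yw: "y \<le> r * x + y" using r by (simp_all add: trans_le_add1)
    have zS: "z \<in> S" and xyS: "x \<le> b \<or> x = u" "y \<le> b \<or> y = u"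
    proof -
      \<comment> \<open>If \<open>r * x + y\<close> is at most \<open>b\<close>, then so are
        \<open>x\<close> and \<open>y\<close>, and only \<open>z\<close> can be \<open>u\<close>.
        Otherwise \<open>S\<close> and \<open>T\<close> agree on \<open>z\<close>, so
        \<open>u\<close> is \<open>x\<close> or \<open>y\<close>; the hypothesis on \<open>b\<close>
        prevents both from exceeding \<open>b\<close>, so the other one is small.\<close>
      consider "r * x + y \<le> b" | "r * x + y > b" by linarith
      then have "z \<in> S \<and> (x \<le> b \<or> x = u) \<and> (y \<le> b \<or> y = u)"
      proof cases
        case 1
        then have "x \<noteq> u" "y \<noteq> u" using ub xw yw by auto
        then have "z = u \<or> x \<in> S \<and> y \<in> S"
          using xyz lowS 1 xw yw by (meson le_trans)
        show ?thesis
        proof (cases "z = u")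
          case True
          then show ?thesis using uS 1 xw yw by auto
        next
          case False
          have "L_free (r * q) q T" using T unfolding maximal_L_free_def by blast
          moreover have "x \<in> T" "y \<in> T" "z \<in> T"
            using xyz \<open>x \<noteq> u\<close> \<open>y \<noteq> u\<close> False by auto
          ultimately show ?thesis
            using z unfolding L_free_mult_iff by blast
        qed
      next
        case 2
        have "z \<noteq> u" using high[OF 2] z uS uT by auto
        then have "z \<in> S" using high[OF 2] z xyz by auto
        have "x = u \<or> y = u"
        proof (rule ccontr)
          assume "\<not> ?thesis"
          then have "x \<in> T" "y \<in> T" "z \<in> T" using xyz \<open>z \<noteq> u\<close> by auto
          moreover have "L_free (r * q) q T" using T unfolding maximal_L_free_def by blast
          ultimately show False
            using z unfolding L_free_mult_iff by blast
        qed
        moreover have "\<not> (x > b \<and> y > b)"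
        proof
          assume "x > b \<and> y > b"
          then have "r * (b + 1) + (b + 1) \<le> r * x + y"
            by (intro add_mono mult_le_mono) auto
          then show False using b wn by (simp add: algebra_simps)
        qed
        ultimately show ?thesis using \<open>z \<in> S\<close> ub by auto
      qed
      then show "z \<in> S" "x \<le> b \<or> x = u" "y \<le> b \<or> y = u" by auto
    qed
    then show False using nosol lowS xyz by blast
  qed
qed

text \<open>For a fixed cut \<open>b\<close>, the map sending \<open>S\<close> to its part up to
  \<open>b\<close> and its set of high multipliers is injective. The cut may depend on
  \<open>S\<close>, which costs the factor \<open>card Bs\<close>.\<close>

lemma f_max_le_of_cuts:
  fixes q r n B v :: nat and \<V> :: "nat \<Rightarrow> nat set set"
  defines "M \<equiv> n div q"
  assumes q: "q \<ge> 1" and r: "r \<ge> 1" and finBs: "finite Bs"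
    and cut: "\<And>S. maximal_L_free (r * q) q n S \<Longrightarrow> \<exists>b\<in>Bs. M < (r + 1) * (b + 1) \<and>
      S \<inter> {1..b} \<in> \<V> b \<and> card {w \<in> {b<..M}. q * w \<in> S} \<le> B"
    and fin\<V>: "\<And>b. b \<in> Bs \<Longrightarrow> finite (\<V> b)" and card\<V>: "\<And>b. b \<in> Bs \<Longrightarrow> card (\<V> b) \<le> v"
  shows "f_max (r * q) q n \<le> card Bs * (v * (M + 1) ^ B)"
proof -
  let ?M = "{S. maximal_L_free (r * q) q n S}"
  let ?high = "\<lambda>b S. {w \<in> {b<..M}. q * w \<in> S}"
  let ?F = "\<lambda>b. {S \<in> ?M. M < (r + 1) * (b + 1) \<and> S \<inter> {1..b} \<in> \<V> b \<and> card (?high b S) \<le> B}"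
  let ?Z = "{Z. Z \<subseteq> {1..M} \<and> card Z \<le> B}"
  have sub: "S \<subseteq> {1..n}" if "S \<in> ?M" for S
    using that unfolding maximal_L_free_def by blast
  have "?M \<subseteq> Pow {1..n}" using sub by blast
  then have finM: "finite ?M" by (rule finite_subset) simp
  have F: "card (?F b) \<le> v * (M + 1) ^ B" if b: "b \<in> Bs" for b
  proof -
    have "inj_on (\<lambda>S. (S \<inter> {1..b}, ?high b S)) (?F b)"
    proof (rule inj_onI)
      fix S T assume S: "S \<in> ?F b" and T: "T \<in> ?F b"
        and eq: "(S \<inter> {1..b}, ?high b S) = (T \<inter> {1..b}, ?high b T)"
      have low: "v \<in> S \<longleftrightarrow> v \<in> T" if "v \<le> b" for v
      proof (cases "v = 0")
        case True
        then show ?thesis using S T sub[of S] sub[of T] by force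
      next
        case False
        then have "v \<in> {1..b}" using that by simp
        then show ?thesis using eq by blast
      qed
      have high: "q * w \<in> S \<longleftrightarrow> q * w \<in> T" if "b < w" for w
      proof (cases "w \<le> M")
        case True
        then have "w \<in> {b<..M}" using that by simp
        then show ?thesis using eq by blast
      next
        case False
        then have "q * w > n"
          using q by (simp add: M_def not_le div_less_iff_less_mult mult.commute)
        then have "q * w \<notin> {1..n}" by simp
        then show ?thesis using S T sub[of S] sub[of T] by blast
      qed
      have b': "n div q < (r + 1) * (b + 1)" using S by (simp add: M_def)
      show "S = T"
      proof
        show "S \<subseteq> T"
          by (rule maximal_L_free_subset_eq[OF q r b']) (use S T low high in auto)
        show "T \<subseteq> S"
          by (rule maximal_L_free_subset_eq[OF q r b']) (use S T low high in auto)
      qed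
    qed
    then have "card (?F b) \<le> card (\<V> b \<times> ?Z)"
      using fin\<V>[OF b] by (intro card_inj_on_le) auto
    also have "\<dots> \<le> v * (M + 1) ^ B"
      using card_subsets_card_le[of "{1..M}" B] card\<V>[OF b]
      by (simp add: card_cartesian_product mult_le_mono)
    finally show ?thesis .
  qed
  have "?M \<subseteq> (\<Union>b\<in>Bs. ?F b)"
  proof
    fix S assume S: "S \<in> ?M"
    then obtain b where "b \<in> Bs" "S \<in> ?F b" using cut[of S] by blast
    then show "S \<in> (\<Union>b\<in>Bs. ?F b)" by blast
  qed
  then have "card ?M \<le> card (\<Union>b\<in>Bs. ?F b)"
    using finBs finM by (intro card_mono) auto
  also have "\<dots> \<le> (\<Sum>b\<in>Bs. card (?F b))" by (rule card_UN_le[OF finBs])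
  also have "\<dots> \<le> card Bs * (v * (M + 1) ^ B)"
    using sum_mono[of Bs "\<lambda>b. card (?F b)" "\<lambda>_. v * (M + 1) ^ B"] F by simp
  finally show ?thesis unfolding f_max_def .
qed

section \<open>Choice of the cut and the explicit bound on the number of maximal sets\<close>

text \<open>Split the line into cells of length \<open>l\<close> and let \<open>b\<close> be the
  right end of the last cell that ends at or beyond \<open>K\<close> and holds at least
  \<open>D\<close> elements of \<open>G\<close>, or \<open>K\<close> if there is none. Every cell
  meeting \<open>G\<close> above \<open>b\<close> is then poor, and at most
  \<open>M div l + 1\<close> cells meet \<open>G\<close>.\<close>

lemma exists_cut:
  fixes G :: "nat set" and K M l D :: nat
  assumes G: "G \<subseteq> {1..M}" and l: "l > 0" and D: "D > 0" and K: "K \<le> M"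
  obtains b where "K \<le> b" "b \<le> M + l" "card (G \<inter> {b<..}) \<le> D * (M div l + 1)"
    "b = K \<or> (\<exists>G'. G' \<subseteq> G \<and> G' \<subseteq> {b - l..<b} \<and> card G' = D)"
proof -
  define cell where "cell j = G \<inter> {j * l..<(j + 1) * l}" for j
  define J where "J = {j. D \<le> card (cell j) \<and> K \<le> (j + 1) * l}"
  have finG: "finite G" using G finite_subset by blast
  have JM: "j * l \<le> M" if "j \<in> J" for j
  proof -
    have "cell j \<noteq> {}" using that D unfolding J_def by auto
    then show ?thesis using G unfolding cell_def by fastforce
  qed
  have "J \<subseteq> {..M div l}" using JM l by (auto simp: less_eq_div_iff_mult_less_eq)
  then have finJ: "finite J" using finite_subset by blast
  define b where "b = (if J = {} then K else (Max J + 1) * l)"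
  have MaxJ: "Max J \<in> J" if "J \<noteq> {}" using finJ that by (rule Max_in)
  have "K \<le> b" using MaxJ unfolding b_def J_def by auto
  moreover have "b \<le> M + l" using JM[OF MaxJ] K unfolding b_def by auto
  moreover have "card (G \<inter> {b<..}) \<le> D * (M div l + 1)"
  proof -
    let ?I = "{j. j \<le> M div l \<and> card (cell j) \<le> D}"
    have "G \<inter> {b<..} \<subseteq> (\<Union>j\<in>?I. cell j)"
    proof
      fix w assume w: "w \<in> G \<inter> {b<..}"
      let ?j = "w div l"
      have up: "w < (?j + 1) * l"
        using l by (metis Suc_eq_plus1 dividend_less_div_times mult_Suc)
      then have wc: "w \<in> cell ?j" using w by (simp add: cell_def)
      have "K \<le> (?j + 1) * l" using \<open>K \<le> b\<close> w up by auto
      \<comment> \<open>\<open>w\<close> lies beyond the right end of the last rich cell, so its own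
        cell has a larger index than \<open>Max J\<close>.\<close>
      moreover have "?j \<notin> J"
      proof
        assume j: "?j \<in> J"
        then have "b = (Max J + 1) * l" unfolding b_def by auto
        then have "(Max J + 1) * l \<le> w" using w by simp
        then have "Max J + 1 \<le> ?j" using l by (simp add: less_eq_div_iff_mult_less_eq)
        then show False using Max_ge[OF finJ j] by simp
      qed
      ultimately have "card (cell ?j) \<le> D" unfolding J_def by auto
      moreover have "?j \<le> M div l" using w G by (intro div_le_mono) auto
      ultimately show "w \<in> (\<Union>j\<in>?I. cell j)" using wc by blast
    qed
    then have "card (G \<inter> {b<..}) \<le> card (\<Union>j\<in>?I. cell j)"
      using finG unfolding cell_def by (intro card_mono) auto
    also have "\<dots> \<le> (\<Sum>j\<in>?I. card (cell j))" by (rule card_UN_le) simp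
    also have "\<dots> \<le> (\<Sum>j\<in>?I. D)" by (rule sum_mono) simp
    also have "\<dots> \<le> (\<Sum>j\<in>{..M div l}. D)" by (rule sum_mono2) auto
    finally show ?thesis by (simp add: mult.commute)
  qed
  moreover have "b = K \<or> (\<exists>G'. G' \<subseteq> G \<and> G' \<subseteq> {b - l..<b} \<and> card G' = D)"
  proof (cases "J = {}")
    case True
    then show ?thesis unfolding b_def by simp
  next
    case False
    then have "D \<le> card (cell (Max J))" using MaxJ unfolding J_def by blast
    then obtain G' where "G' \<subseteq> cell (Max J)" "card G' = D"
      by (meson obtain_subset_with_card_n)
    then show ?thesis using False unfolding b_def cell_def by auto
  qed
  ultimately show ?thesis using that by blast
qed

text \<open>Here \<open>t\<close> is the integer fourth root of \<open>n\<close>. Cells of length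
  \<open>t ^ 3\<close> with threshold \<open>t * t\<close> balance the errors: the cell length, the
  number of high multiples (about \<open>M / t\<close>) and the container loss
  \<open>b div t\<close> are all of order at most \<open>t ^ 3\<close>, that is, \<open>n\<close> to
  the power 3/4.\<close>

lemma f_max_le:
  fixes q r n t :: nat
  defines "M \<equiv> n div q"
  assumes q: "q \<ge> 1" and r: "r \<ge> 1" and t: "t \<ge> 1" and tn: "t ^ 4 \<le> n" "n < (t + 1) ^ 4"
  shows "f_max (r * q) q n \<le> (2 * n + 2) ^ (51 * t ^ 3) * 2 ^ (M - M div (r + 1) + 36 * t ^ 3)"
proof -
  let ?N = "2 * n + 2"
  define K where "K = M div (r + 1)"
  define B where "B = t * t * (M div t ^ 3 + 1)"
  \<comment> \<open>The 33 is 1 for the choice of the gap set plus 32 for \<open>b div t\<close>, as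
    \<open>b \<le> 2 * n \<le> 32 * t ^ 4\<close>. The 36 collects the same 32, a further 2 from the
    position of the cell, and 2 for rounding.\<close>
  define v where "v = ?N ^ (33 * t ^ 3) * 2 ^ (M - K + 36 * t ^ 3)"
  let ?Av = "\<lambda>G b. {V. V \<subseteq> {1..b} \<and> (\<forall>x\<in>V. \<forall>y\<in>V. r * x + y \<notin> G)}"
  define \<G> where "\<G> b = {G. G \<subseteq> {1..M} \<and> G \<subseteq> {b - t ^ 3..<b} \<and> card G = t * t}" for b
  define \<V> where "\<V> b = (if b = K then Pow {1..b} else (\<Union>G\<in>\<G> b. ?Av G b))" for b
  have Mn: "M \<le> n" unfolding M_def by simp
  have rK: "(r + 1) * K \<le> M" unfolding K_def by (simp only: times_div_less_eq_dividend)
  have MK: "M < (r + 1) * (K + 1)"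
    unfolding K_def using dividend_less_times_div[of "r + 1" M] by (simp add: algebra_simps)
  have rK': "r * K + K \<le> M" using rK by simp
  have K2: "K + K \<le> M" using rK' mult_le_mono1[OF r, of K] by linarith
  have t34: "t ^ 3 \<le> n"
    using power_increasing[of 3 4 t] t tn(1) by simp
  have t23: "t * t \<le> t ^ 3" "1 \<le> t ^ 3" using t by (simp_all add: power3_eq_cube)
  have n16: "n \<le> 16 * t ^ 4"
  proof -
    have "(t + 1) ^ 4 \<le> (2 * t) ^ 4" using t by (intro power_mono) auto
    then show ?thesis using tn(2) by (simp add: power_mult_distrib)
  qed
  have t4: "t ^ 4 = t * t ^ 3" by (simp add: power_numeral_reduce)
  have BN: "B \<le> 17 * t ^ 3"
  proof -
    have "M div t ^ 3 \<le> 16 * t * t ^ 3 div t ^ 3"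
      using Mn n16 by (intro div_le_mono) (simp add: t4)
    then have "M div t ^ 3 + 1 \<le> 17 * t" using t by simp
    then have "t * t * (M div t ^ 3 + 1) \<le> t * t * (17 * t)" by (rule mult_le_mono2)
    then show ?thesis by (simp add: B_def power3_eq_cube)
  qed
  have cardV: "card (\<V> b) \<le> v" if b: "b \<in> {..M + t ^ 3}" for b
  proof (cases "b = K")
    \<comment> \<open>At the lowest cut no rich cell need exist, but all subsets of
      \<open>{1..K}\<close> are affordable: \<open>r \<ge> 1\<close> gives
      \<open>K \<le> M - K\<close>.\<close>
    case True
    then have "card (\<V> b) = 1 * 2 ^ K" by (simp add: \<V>_def card_Pow)
    also have "\<dots> \<le> v"
      unfolding v_def using K2 by (intro mult_le_mono power_increasing) auto
    finally show ?thesis .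
  next
    case False
    \<comment> \<open>The largest \<open>c\<close> for which \<open>(r + 1) * c\<close> stays below
      every gap in \<open>{b - t ^ 3..<b}\<close>. When the subtraction truncates,
      \<open>c = 0\<close> and the positivity of gaps is what keeps the inequality strict.\<close>
    define c where "c = (b - t ^ 3 - 1) div (r + 1)"
    have "c \<le> b" unfolding c_def by (meson diff_le_self div_le_dividend le_trans)
    have bt: "b div t \<le> 32 * t ^ 3"
    proof -
      have "b \<le> 32 * t ^ 3 * t" using b Mn t34 n16 by (simp add: t4 algebra_simps)
      then show ?thesis using t div_le_mono[of b "32 * t ^ 3 * t" t] by simp
    qed
    \<comment> \<open>In essence \<open>b - c\<close> is \<open>r * b / (r + 1)\<close> with
      \<open>b\<close> barely above \<open>M\<close>. If the bound failed, comparison with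
      \<open>r * K + K \<le> M\<close> would force \<open>K \<le> c\<close>, and then
      \<open>b\<close> would exceed \<open>M + t ^ 3\<close>.\<close>
    have bc: "b - c \<le> M - K + 2 * t ^ 3 + 2"
    proof (rule ccontr)
      assume "\<not> ?thesis"
      then have *: "c + M + 2 * t ^ 3 + 2 < b + K" using K2 \<open>c \<le> b\<close> by linarith
      have "b - t ^ 3 - 1 < (r + 1) * (c + 1)"
        unfolding c_def using dividend_less_times_div[of "r + 1" "b - t ^ 3 - 1"]
        by (simp add: algebra_simps)
      then have "r * K < r * (c + 1)" using * rK' b by (simp add: algebra_simps)
      then have "K < c + 1" by (simp only: mult_less_cancel1)
      then show False using * b by simp
    qed
    have "card (\<V> b) \<le> (\<Sum>G\<in>\<G> b. card (?Av G b))"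
      using False unfolding \<V>_def \<G>_def by (simp add: card_UN_le)
    also have "\<dots> \<le> (\<Sum>G\<in>\<G> b. (b + 1) ^ (b div t) * 2 ^ (b - c + b div t))"
    proof (rule sum_mono)
      fix G assume G: "G \<in> \<G> b"
      show "card (?Av G b) \<le> (b + 1) ^ (b div t) * 2 ^ (b - c + b div t)"
      proof (rule card_sum_avoiding_le[OF r _ \<open>c \<le> b\<close>])
        show "t > 0" using t by simp
        show "G \<subseteq> {..b}" "card G = t * t" using G unfolding \<G>_def by auto
        show "(r + 1) * c < g" if "g \<in> G" for g
        proof -
          have "(r + 1) * c \<le> b - t ^ 3 - 1"
            unfolding c_def by (simp only: times_div_less_eq_dividend)
          moreover have "g \<ge> 1" "g \<ge> b - t ^ 3" using G that unfolding \<G>_def by auto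
          ultimately show ?thesis by linarith
        qed
      qed
    qed
    also have "\<dots> = card (\<G> b) * ((b + 1) ^ (b div t) * 2 ^ (b - c + b div t))" by simp
    also have "\<dots> \<le> ?N ^ t ^ 3 * (?N ^ (32 * t ^ 3) * 2 ^ (M - K + 36 * t ^ 3))"
    proof (intro mult_le_mono)
      have "card (\<G> b) \<le> card {A. A \<subseteq> {1..M} \<and> card A \<le> t * t}"
        unfolding \<G>_def by (intro card_mono) auto
      also have "\<dots> \<le> (M + 1) ^ (t * t)"
        using card_subsets_card_le[of "{1..M}" "t * t"] by simp
      also have "\<dots> \<le> ?N ^ (t * t)" using Mn by (intro power_mono) auto
      also have "\<dots> \<le> ?N ^ t ^ 3" using t23 by (intro power_increasing) auto
      finally show "card (\<G> b) \<le> ?N ^ t ^ 3" .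
      have "(b + 1) ^ (b div t) \<le> ?N ^ (b div t)"
        using b Mn t34 by (intro power_mono) auto
      also have "\<dots> \<le> ?N ^ (32 * t ^ 3)" using bt by (intro power_increasing) auto
      finally show "(b + 1) ^ (b div t) \<le> ?N ^ (32 * t ^ 3)" .
      show "(2::nat) ^ (b - c + b div t) \<le> 2 ^ (M - K + 36 * t ^ 3)"
        using bc bt t23 by (intro power_increasing) auto
    qed
    also have "\<dots> = v" by (simp add: v_def mult.assoc flip: power_add)
    finally show ?thesis .
  qed
  have "f_max (r * q) q n \<le> card {..M + t ^ 3} * (v * (M + 1) ^ B)"
    unfolding M_def
  proof (rule f_max_le_of_cuts[OF q r])
    show "finite {..n div q + t ^ 3}" by simp
    show "finite (\<V> b)" for b unfolding \<V>_def \<G>_def by simp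
    show "card (\<V> b) \<le> v" if "b \<in> {..n div q + t ^ 3}" for b
      using cardV that by (simp add: M_def)
  next
    fix S assume S: "maximal_L_free (r * q) q n S"
    then have free: "L_free (r * q) q S" unfolding maximal_L_free_def by blast
    define G where "G = {w \<in> {1..M}. \<forall>x\<in>S. \<forall>y\<in>S. r * x + y \<noteq> w}"
    have "G \<subseteq> {1..M}" "0 < t ^ 3" "0 < t * t" "K \<le> M"
      using t K2 unfolding G_def by auto
    then obtain b where b: "K \<le> b" "b \<le> M + t ^ 3" "card (G \<inter> {b<..}) \<le> B"
      "b = K \<or> (\<exists>G'. G' \<subseteq> G \<and> G' \<subseteq> {b - t ^ 3..<b} \<and> card G' = t * t)"
      unfolding B_def by (rule exists_cut)
    have "S \<inter> {1..b} \<in> \<V> b"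
    proof (cases "b = K")
      case True
      then show ?thesis by (simp add: \<V>_def)
    next
      case False
      then obtain G' where G': "G' \<subseteq> G" "G' \<subseteq> {b - t ^ 3..<b}" "card G' = t * t"
        using b(4) by blast
      then have "G' \<in> \<G> b" unfolding \<G>_def G_def by auto
      moreover have "S \<inter> {1..b} \<in> ?Av G' b" using G'(1) unfolding G_def by blast
      ultimately show ?thesis using False unfolding \<V>_def by auto
    qed
    moreover have "card {w \<in> {b<..M}. q * w \<in> S} \<le> B"
    proof -
      have "{w \<in> {b<..M}. q * w \<in> S} \<subseteq> G \<inter> {b<..}"
        using free unfolding G_def L_free_mult_iff by fastforce
      then have "card {w \<in> {b<..M}. q * w \<in> S} \<le> card (G \<inter> {b<..})"
        by (intro card_mono) (auto simp: G_def)
      then show ?thesis using b(3) by simp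
    qed
    moreover have "M < (r + 1) * (b + 1)"
      using MK b(1) mult_le_mono2[of "K + 1" "b + 1" "r + 1"] by linarith
    ultimately show "\<exists>b\<in>{..n div q + t ^ 3}. n div q < (r + 1) * (b + 1) \<and>
      S \<inter> {1..b} \<in> \<V> b \<and> card {w \<in> {b<..n div q}. q * w \<in> S} \<le> B"
      using b(2) unfolding M_def by blast
  qed
  also have "\<dots> \<le> ?N ^ t ^ 3 * (v * ?N ^ (17 * t ^ 3))"
  proof (intro mult_le_mono)
    have "card {..M + t ^ 3} \<le> ?N ^ 1" using Mn t34 by simp
    also have "\<dots> \<le> ?N ^ t ^ 3" using t23 by (intro power_increasing) auto
    finally show "card {..M + t ^ 3} \<le> ?N ^ t ^ 3" .
    have "(M + 1) ^ B \<le> ?N ^ B" using Mn by (intro power_mono) auto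
    also have "\<dots> \<le> ?N ^ (17 * t ^ 3)" using BN by (intro power_increasing) auto
    finally show "(M + 1) ^ B \<le> ?N ^ (17 * t ^ 3)" .
  qed auto
  also have "\<dots> = ?N ^ (51 * t ^ 3) * 2 ^ (M - K + 36 * t ^ 3)"
  proof -
    \<comment> \<open>The three factors count the cuts, the lower parts and the sets of high
      multipliers.\<close>
    have "?N ^ (51 * t ^ 3) = ?N ^ t ^ 3 * ?N ^ (33 * t ^ 3) * ?N ^ (17 * t ^ 3)"
      by (simp flip: power_add)
    then show ?thesis by (simp only: v_def ac_simps)
  qed
  finally show ?thesis unfolding K_def .
qed

section \<open>Bounds on \<open>mu\<close> and \<open>mu_star\<close>\<close>

text \<open>The interval of all numbers above \<open>n div (p + q)\<close> is solution-free, because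
  the least value of \<open>p * x + q * y\<close> on it already exceeds \<open>n\<close>.\<close>

lemma mu_ge:
  assumes "p + q > 0"
  shows "n - n div (p + q) \<le> mu p q n"
proof -
  let ?A = "{n div (p + q)<..n}"
  have "L_free p q ?A"
    unfolding L_free_def solution_def
  proof clarify
    fix x y assume "x \<in> ?A" "y \<in> ?A" and z: "p * x + q * y \<in> ?A"
    then have "p * (n div (p + q) + 1) + q * (n div (p + q) + 1) \<le> p * x + q * y"
      by (intro add_mono mult_le_mono2) auto
    moreover have "n < (p + q) * (n div (p + q) + 1)"
      using dividend_less_times_div[OF assms, of n] by (simp add: algebra_simps)
    ultimately show False using z by (simp add: algebra_simps)
  qed
  then have "?A \<in> {A. A \<subseteq> {1..n} \<and> L_free p q A}" by auto
  then have "card ?A \<le> mu p q n"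
    unfolding mu_def by (intro Max_ge imageI) simp_all
  then show ?thesis by simp
qed

text \<open>Solutions with \<open>x = 1\<close> already cover many elements: each
  \<open>a \<le> M - r\<close> occurs as \<open>y\<close>, and each \<open>q * w\<close> with
  \<open>r < w \<le> M\<close> occurs as \<open>z\<close>. Restricting to \<open>w > M div q\<close>
  makes the two families disjoint, as then \<open>q * w > M\<close>.\<close>

lemma mu_star_le:
  fixes q r n :: nat
  defines "M \<equiv> n div q"
  assumes q: "q \<ge> 1"
  shows "mu_star (r * q) q n + (M - r) + (M - max (M div q) r) \<le> n"
proof -
  let ?T = "{a \<in> {1..n}. \<exists>x\<in>{1..n}. \<exists>y\<in>{1..n}. \<exists>z\<in>{1..n}.
    q * (r * x + y) = z \<and> a \<in> {x, y, z}}"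
  let ?U = "{a \<in> {1..n}. \<not> (\<exists>M. L_triple (r * q) q M \<and> set_mset M \<subseteq> {1..n} \<and> a \<in># M)}"
  let ?H = "(\<lambda>w. q * w) ` {max (M div q) r<..M}"
  have qM: "q * w \<le> n" if "w \<le> M" for w
    using that q by (simp add: M_def less_eq_div_iff_mult_less_eq mult.commute)
  have Mn: "M \<le> n" unfolding M_def by simp
  have low: "{1..M - r} \<subseteq> ?T"
  proof
    fix a assume a: "a \<in> {1..M - r}"
    then have "r + a \<le> M" "r + a \<ge> 1" by auto
    then have "q * (r * 1 + a) \<in> {1..n}" using qM[of "r + a"] q by (simp add: Suc_le_eq)
    moreover have "a \<in> {1..n}" "1 \<in> {1..n}" using a Mn by auto
    ultimately show "a \<in> ?T" by blast
  qed
  have high: "?H \<subseteq> ?T"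
  proof
    fix a assume "a \<in> ?H"
    then obtain w where "a = q * w" "w \<in> {max (M div q) r<..M}" by (rule imageE)
    then have w: "a = q * w" "r < w" "w \<le> M" by auto
    then have "a \<in> {1..n}" using qM q by simp
    moreover have "w - r \<in> {1..n}" "1 \<in> {1..n}" using w Mn by auto
    moreover have "q * (r * 1 + (w - r)) = a" using w by simp
    ultimately show "a \<in> ?T" by blast
  qed
  have disj: "{1..M - r} \<inter> ?H = {}"
  proof -
    have "M < q * w" if "M div q < w" for w
      using that q by (simp add: div_less_iff_less_mult mult.commute)
    then show ?thesis by fastforce
  qed
  have TU: "?T \<inter> ?U = {}"
  proof -
    have "\<exists>M. L_triple (r * q) q M \<and> set_mset M \<subseteq> {1..n} \<and> a \<in># M" if "a \<in> ?T" for a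
    proof -
      from that obtain x y z where xyz: "x \<in> {1..n}" "y \<in> {1..n}" "z \<in> {1..n}"
        "q * (r * x + y) = z" "a \<in> {x, y, z}" by blast
      have "L_triple (r * q) q {#x, y, z#}"
        unfolding L_triple_def solution_def using xyz(4)
        by (intro exI[of _ x] exI[of _ y] exI[of _ z]) (auto simp: algebra_simps)
      then show ?thesis using xyz by (intro exI[of _ "{#x, y, z#}"]) auto
    qed
    then show ?thesis by blast
  qed
  have "(M - r) + (M - max (M div q) r) = card ({1..M - r} \<union> ?H)"
    using disj q by (subst card_Un_disjoint) (auto simp: card_image inj_on_def)
  also have "\<dots> \<le> card ?T" using low high by (intro card_mono) auto
  finally have "(M - r) + (M - max (M div q) r) + mu_star (r * q) q n \<le> card ?T + card ?U"
    unfolding mu_star_def by simp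
  also have "\<dots> = card (?T \<union> ?U)" using TU by (subst card_Un_disjoint) auto
  also have "\<dots> \<le> card {1..n}" by (intro card_mono) auto
  finally show ?thesis by simp
qed

section \<open>Comparison of the exponents and the sublinear error term\<close>

theorem theorem5:
  fixes p q :: nat
  assumes "p \<ge> q" and "q \<ge> 2" and "p \<le> q\<^sup>2 - q" and "gcd p q = q"
  shows "\<exists>e :: nat \<Rightarrow> real. e \<in> o(\<lambda>n. real n) \<and>
    (\<forall>n. real (f_max p q n) \<le> 2 powr ((real (mu p q n) - real (mu_star p q n)) / 2 + e n))"
proof -
  have "q dvd p" using assms(4) by (metis gcd_dvd1)
  then obtain r where p: "p = r * q" by (metis dvd_div_mult_self)
  have q: "q \<ge> 1" using assms(2) by simp
  have r: "r \<ge> 1" using assms(1) q p by (cases r) auto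
  have "(r + 1) * q \<le> q * q"
    using assms(3) p q by (simp add: power2_eq_square algebra_simps le_diff_conv2)
  then have rq: "r + 1 \<le> q" using q by (simp only: mult_le_cancel2)
  \<comment> \<open>The constant \<open>r\<close> is the loss in the bound on
    \<open>mu_star\<close>; the other terms are the errors of order \<open>t ^ 3\<close>, the first
    carrying a logarithm from rewriting powers of \<open>2 * n + 2\<close> in base 2.\<close>
  define e where "e n = real r + 51 * real n powr (3/4) * log 2 (2 * real n + 2)
    + 36 * real n powr (3/4)" for n
  have "e \<in> o(\<lambda>n. real n)" unfolding e_def by real_asymp
  moreover have "real (f_max p q n) \<le> 2 powr ((real (mu p q n) - real (mu_star p q n)) / 2 + e n)" for n
  proof -
    define M where "M = n div q"
    define K where "K = M div (r + 1)"
    have KM: "K \<le> M" unfolding K_def by simp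
    have "n div (p + q) = K"
      by (simp add: p K_def M_def algebra_simps flip: div_mult2_eq)
    then have "n - K \<le> mu p q n" using mu_ge[of p q n] q by simp
    moreover have "mu_star p q n + (M - r) + (M - max (M div q) r) \<le> n"
      using mu_star_le[OF q, of r n] by (simp add: p M_def)
    \<comment> \<open>This is where \<open>p \<le> q\<^sup>2 - q\<close> enters, through
      \<open>r + 1 \<le> q\<close>: at least \<open>M - K - r\<close> multiples of \<open>q\<close>
      are counted in the bound on \<open>mu_star\<close>, so \<open>mu - mu_star\<close> is at least
      \<open>2 * (M - K) - 2 * r\<close>.\<close>
    moreover have "M div q \<le> K" unfolding K_def using rq by (intro div_le_mono2) auto
    ultimately have "2 * M + mu_star p q n \<le> mu p q n + 2 * K + 2 * r"
      by linarith
    then have "2 * real M + real (mu_star p q n) \<le> real (mu p q n) + 2 * real K + 2 * real r"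
      by linarith
    then have MK: "real (M - K) \<le> (real (mu p q n) - real (mu_star p q n)) / 2 + real r"
      unfolding of_nat_diff[OF KM] by (simp add: field_simps)
    show ?thesis
    proof (cases "n = 0")
      \<comment> \<open>For \<open>n = 0\<close> no \<open>t \<ge> 1\<close> satisfies
        \<open>t ^ 4 \<le> n\<close>, so this case is settled directly.\<close>
      case True
      have "f_max p q n \<le> card {S. S \<subseteq> {1..n}}"
        unfolding f_max_def maximal_L_free_def by (intro card_mono) auto
      also have "\<dots> = 1" using True by simp
      finally have "real (f_max p q n) \<le> 1" by simp
      also have "1 \<le> 2 powr ((real (mu p q n) - real (mu_star p q n)) / 2 + e n)"
        using MK True by (intro ge_one_powr_ge_zero) (simp_all add: e_def)
      finally show ?thesis .
    next
      case False
      obtain s where s: "n < s ^ 4" and smin: "\<And>i. i < s \<Longrightarrow> \<not> n < i ^ 4"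
      proof -
        have "n < (n + 1) ^ 4"
          using self_le_power[of "n + 1" 4] by linarith
        then show ?thesis using that ex_least_nat_le[of "\<lambda>s. n < s ^ 4"] by blast
      qed
      have "s > 1"
      proof (rule ccontr)
        assume "\<not> s > 1"
        then have "s = 0 \<or> s = 1" by auto
        then show False using s False by auto
      qed
      define t where "t = s - 1"
      have t: "t \<ge> 1" "n < (t + 1) ^ 4" "t ^ 4 \<le> n"
        using \<open>s > 1\<close> s smin[of t] by (auto simp: t_def)
      define m where "m = t ^ 3"
      let ?N = "2 * real n + 2" and ?x = "real n powr (3/4)"
      have mx: "real m \<le> ?x"
      proof -
        have "real m = real t powr (4 * (3/4))" using t(1) by (simp add: m_def)
        also have "\<dots> = (real t powr 4) powr (3/4)" by (rule powr_powr[symmetric])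
        also have "real t powr 4 = real (t ^ 4)" using t(1) by simp
        also have "\<dots> powr (3/4) \<le> ?x"
          by (intro powr_mono2 of_nat_mono t(3)) simp_all
        finally show ?thesis .
      qed
      have "real (f_max p q n) \<le> real ((2 * n + 2) ^ (51 * m) * 2 ^ (M - K + 36 * m))"
        using f_max_le[OF q r t(1) t(3) t(2)] unfolding p K_def M_def m_def of_nat_le_iff .
      also have "\<dots> = ?N ^ (51 * m) * 2 ^ (M - K + 36 * m)" by (simp add: add.commute)
      also have "?N ^ (51 * m) = (2 powr log 2 ?N) powr real (51 * m)"
        by (subst powr_log_cancel; (subst powr_realpow)?) simp_all
      also have "\<dots> = 2 powr (log 2 ?N * real (51 * m))" by (rule powr_powr)
      also have "(2::real) ^ (M - K + 36 * m) = 2 powr real (M - K + 36 * m)"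
        by (rule powr_realpow[symmetric]) simp
      also have "2 powr (log 2 ?N * real (51 * m)) * 2 powr real (M - K + 36 * m)
          = 2 powr (log 2 ?N * real (51 * m) + real (M - K + 36 * m))"
        by (rule powr_add[symmetric])
      also have "\<dots> \<le> 2 powr ((real (mu p q n) - real (mu_star p q n)) / 2 + e n)"
      proof (rule powr_mono)
        have "51 * real m * log 2 ?N \<le> 51 * ?x * log 2 ?N"
          using mx by (intro mult_right_mono) auto
        moreover have "log 2 ?N * real (51 * m) = 51 * real m * log 2 ?N" by simp
        moreover have "real (M - K + 36 * m) = real (M - K) + 36 * real m" by simp
        ultimately show "log 2 ?N * real (51 * m) + real (M - K + 36 * m)
            \<le> (real (mu p q n) - real (mu_star p q n)) / 2 + e n"
          using MK mx unfolding e_def by linarith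
      qed simp
      finally show ?thesis .
    qed
  qed
  ultimately show ?thesis by blast
qed

end
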